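(* Let $G$ be a finite undirected graph (multiple edges and loops allowed), and let $I$ be an ideal of $\mathrm{Fisg}(G)$ with basis $\mathcal B$. Then $\mathcal B$ is unique up to isomorphism; that is, if $\mathcal C$ is another basis of $I$, then there is a bijection $\mathcal B\to\mathcal C$ sending each graph in $\mathcal B$ to a graph in $\mathcal C$ isomorphic to it.
   Context: Graphs are finite and undirected and may have multiple edges and loops; the empty graph $\emptyset$ counts as a graph (and as a subgraph of every graph) and the empty map $\mu_0:\emptyset\to\emptyset$ counts as a graph isomorphism. For a graph $G$, $\mathrm{Fisg}(G)$ is the set of all graph isomorphisms $\varphi:H\to J$ (bijections on vertices and on edges preserving incidence) where $H$ and $J$ are subgraphs of $G$. For $\varphi,\psi\in\mathrm{Fisg}(G)$ the product $\psi\circ\varphi$ is the composition of partial maps, with domain $\varphi^{-1}(\mathrm{Im}(\varphi)\cap\mathrm{Dom}(\psi))$ and image $\psi(\mathrm{Im}(\varphi)\cap\mathrm{Dom}(\psi))$. With this product $\mathrm{Fisg}(G)$ is an inverse semigroup. An ideal of a semigroup $S$ is a subset $I\subseteq S$ with $SI\subseteq I$ and $IS\subseteq I$. A generating set of graphs of an ideal $I$ of $\mathrm{Fisg}(G)$ is a family $\mathcal B$ of graphs such that (i) for every $a\in I$, $a:H\to K$, the graph $H$ is isomorphic to a subgraph of some $B\in\mathcal B$, and (ii) every $B\in\mathcal B$ is the domain of some $\alpha\in I$. A basis of $I$ is a generating set of graphs of $I$ that is minimal (with respect to inclusion) among generating sets of graphs of $I$. *)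

theory Defs
  imports Main "HOL-Library.Uprod"
begin

text \<open>
  The edge set of a graph is the domain of its partial incidence map, which sends an edge to the
  unordered pair of its ends (a loop at \<open>v\<close> has ends \<open>Upair v v\<close>). Since nothing is recorded outside
  the graph, HOL equality of records is equality of graphs. The empty graph is allowed.
\<close>

record ('v, 'e) mgraph =
  verts :: "'v set"
  ends :: "'e \<Rightarrow> 'v uprod option"

definition edges :: "('v, 'e) mgraph \<Rightarrow> 'e set" where
  "edges G = dom (ends G)"

definition wf_mgraph :: "('v, 'e) mgraph \<Rightarrow> bool" where
  "wf_mgraph G \<longleftrightarrow> finite (verts G) \<and> finite (edges G) \<and>
     (\<forall>e d. ends G e = Some d \<longrightarrow> set_uprod d \<subseteq> verts G)"

definition subgraph :: "('v, 'e) mgraph \<Rightarrow> ('v, 'e) mgraph \<Rightarrow> bool" where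
  "subgraph H G \<longleftrightarrow> wf_mgraph H \<and> wf_mgraph G \<and> verts H \<subseteq> verts G \<and> ends H \<subseteq>\<^sub>m ends G"

text \<open>
  An arrow carries its domain and image graphs together with partial maps on vertices and edges
  that are defined exactly on the domain graph, so equality of records is again the intended one.
\<close>

record ('v, 'e) garrow =
  Dom :: "('v, 'e) mgraph"
  Img :: "('v, 'e) mgraph"
  vmap :: "'v \<Rightarrow> 'v option"
  emap :: "'e \<Rightarrow> 'e option"

definition graph_iso :: "('v, 'e) garrow \<Rightarrow> bool" where
  "graph_iso \<phi> \<longleftrightarrow> wf_mgraph (Dom \<phi>) \<and> wf_mgraph (Img \<phi>) \<and>
     dom (vmap \<phi>) = verts (Dom \<phi>) \<and> ran (vmap \<phi>) = verts (Img \<phi>) \<and>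
     inj_on (vmap \<phi>) (verts (Dom \<phi>)) \<and>
     dom (emap \<phi>) = edges (Dom \<phi>) \<and> ran (emap \<phi>) = edges (Img \<phi>) \<and>
     inj_on (emap \<phi>) (edges (Dom \<phi>)) \<and>
     (\<forall>e d. ends (Dom \<phi>) e = Some d \<longrightarrow>
        ends (Img \<phi>) (the (emap \<phi> e)) = Some (map_uprod (\<lambda>v. the (vmap \<phi> v)) d))"

definition isomorphic :: "('v, 'e) mgraph \<Rightarrow> ('v, 'e) mgraph \<Rightarrow> bool" where
  "isomorphic H J \<longleftrightarrow> (\<exists>\<phi>. graph_iso \<phi> \<and> Dom \<phi> = H \<and> Img \<phi> = J)"

definition Fisg :: "('v, 'e) mgraph \<Rightarrow> ('v, 'e) garrow set" where
  "Fisg G = {\<phi>. graph_iso \<phi> \<and> subgraph (Dom \<phi>) G \<and> subgraph (Img \<phi>) G}"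

text \<open>
  Intersection is only used for subgraphs of a common graph, whose incidence maps agree on common
  edges.
\<close>

definition graph_inter :: "('v, 'e) mgraph \<Rightarrow> ('v, 'e) mgraph \<Rightarrow> ('v, 'e) mgraph" where
  "graph_inter H K = \<lparr>verts = verts H \<inter> verts K, ends = ends H |` edges K\<rparr>"

definition image_graph :: "('v, 'e) garrow \<Rightarrow> ('v, 'e) mgraph \<Rightarrow> ('v, 'e) mgraph" where
  "image_graph \<phi> M =
     \<lparr>verts = {w. \<exists>v\<in>verts M. vmap \<phi> v = Some w},
      ends = ends (Img \<phi>) |` {f. \<exists>e\<in>edges M. emap \<phi> e = Some f}\<rparr>"

definition preimage_graph :: "('v, 'e) garrow \<Rightarrow> ('v, 'e) mgraph \<Rightarrow> ('v, 'e) mgraph" where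
  "preimage_graph \<phi> M =
     \<lparr>verts = {v. \<exists>w\<in>verts M. vmap \<phi> v = Some w},
      ends = ends (Dom \<phi>) |` {e. \<exists>f\<in>edges M. emap \<phi> e = Some f}\<rparr>"

definition arrow_comp :: "('v, 'e) garrow \<Rightarrow> ('v, 'e) garrow \<Rightarrow> ('v, 'e) garrow" where
  "arrow_comp \<psi> \<phi> =
     \<lparr>Dom = preimage_graph \<phi> (graph_inter (Img \<phi>) (Dom \<psi>)),
      Img = image_graph \<psi> (graph_inter (Img \<phi>) (Dom \<psi>)),
      vmap = vmap \<psi> \<circ>\<^sub>m vmap \<phi>,
      emap = emap \<psi> \<circ>\<^sub>m emap \<phi>\<rparr>"

definition semigroup_ideal :: "'a set \<Rightarrow> ('a \<Rightarrow> 'a \<Rightarrow> 'a) \<Rightarrow> 'a set \<Rightarrow> bool" where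
  "semigroup_ideal S mul I \<longleftrightarrow> I \<subseteq> S \<and> (\<forall>s\<in>S. \<forall>a\<in>I. mul s a \<in> I \<and> mul a s \<in> I)"

text \<open>
  Condition (ii) forces the members of a generating set to be subgraphs of the ambient graph, so
  it is no restriction that they live over the same vertex and edge types.
\<close>

definition generating_graphs :: "('v, 'e) garrow set \<Rightarrow> ('v, 'e) mgraph set \<Rightarrow> bool" where
  "generating_graphs I \<B> \<longleftrightarrow>
     (\<forall>a\<in>I. \<exists>B\<in>\<B>. \<exists>J. subgraph J B \<and> isomorphic (Dom a) J) \<and>
     (\<forall>B\<in>\<B>. \<exists>\<alpha>\<in>I. Dom \<alpha> = B)"

definition ideal_basis :: "('v, 'e) garrow set \<Rightarrow> ('v, 'e) mgraph set \<Rightarrow> bool" where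
  "ideal_basis I \<B> \<longleftrightarrow>
     generating_graphs I \<B> \<and> (\<forall>\<C>. \<C> \<subset> \<B> \<longrightarrow> \<not> generating_graphs I \<C>)"

end

(* Embeddability is a preorder on graphs, and for finite graphs mutual embeddability means
   isomorphism, by counting vertices and edges. By minimality a basis is an antichain for this
   preorder. Each member B of one basis embeds into some C of the other, which embeds into some B'
   of the first; hence B = B' and B is isomorphic to C, and the antichain property of both bases
   makes the assignment of C to B bijective. *)

theory Submission
  imports Defs
begin

text \<open>Total functions compose without bookkeeping; for well-formed \<open>H\<close> their
  values off \<open>H\<close> do not matter. That \<open>g\<close> sends edges to edges is hidden in
  the last clause, which makes \<open>ends K\<close> defined at \<open>g e\<close>.\<close>

definition graph_embedding ::
    "('v \<Rightarrow> 'v) \<Rightarrow> ('e \<Rightarrow> 'e) \<Rightarrow> ('v, 'e) mgraph \<Rightarrow> ('v, 'e) mgraph \<Rightarrow> bool" where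
  "graph_embedding f g H K \<longleftrightarrow>
     inj_on f (verts H) \<and> f ` verts H \<subseteq> verts K \<and> inj_on g (edges H) \<and>
     (\<forall>e d. ends H e = Some d \<longrightarrow> ends K (g e) = Some (map_uprod f d))"

text \<open>The relation through which the first clause of \<open>generating_graphs\<close> compares
  domains of arrows with members of the family.\<close>

definition embeds :: "('v, 'e) mgraph \<Rightarrow> ('v, 'e) mgraph \<Rightarrow> bool" where
  "embeds H K \<longleftrightarrow> (\<exists>J. subgraph J K \<and> isomorphic H J)"

lemma graph_embedding_edges: "graph_embedding f g H K \<Longrightarrow> g ` edges H \<subseteq> edges K"
  by (auto simp: graph_embedding_def edges_def)

lemma graph_embedding_trans:
  assumes "graph_embedding f g H K" "graph_embedding f' g' K L"
  shows "graph_embedding (f' \<circ> f) (g' \<circ> g) H L"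
proof -
  have "inj_on (f' \<circ> f) (verts H)" "inj_on (g' \<circ> g) (edges H)"
    using assms graph_embedding_edges[OF assms(1)]
    by (auto simp: graph_embedding_def intro!: comp_inj_on intro: inj_on_subset)
  moreover have "(f' \<circ> f) ` verts H \<subseteq> verts L"
    using assms by (fastforce simp: graph_embedding_def)
  moreover have "ends L ((g' \<circ> g) e) = Some (map_uprod (f' \<circ> f) d)" if "ends H e = Some d" for e d
    using assms that by (simp add: graph_embedding_def uprod.map_comp)
  ultimately show ?thesis
    by (simp add: graph_embedding_def)
qed

text \<open>The partial maps of an arrow are defined on its whole domain graph, so
  \<open>the\<close> only strips \<open>Some\<close> there and preserves injectivity.\<close>

lemma graph_iso_imp_embedding:
  assumes "graph_iso \<phi>"
  shows "graph_embedding (\<lambda>v. the (vmap \<phi> v)) (\<lambda>e. the (emap \<phi> e)) (Dom \<phi>) (Img \<phi>)"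
proof -
  have "inj_on (\<lambda>v. the (vmap \<phi> v)) (verts (Dom \<phi>))"
  proof (rule inj_onI)
    fix x y
    assume xy: "x \<in> verts (Dom \<phi>)" "y \<in> verts (Dom \<phi>)" "the (vmap \<phi> x) = the (vmap \<phi> y)"
    then have "x \<in> dom (vmap \<phi>)" "y \<in> dom (vmap \<phi>)"
      using assms by (auto simp: graph_iso_def)
    with xy have "vmap \<phi> x = vmap \<phi> y"
      by auto
    with xy show "x = y"
      using assms by (auto simp: graph_iso_def dest: inj_onD)
  qed
  moreover have "inj_on (\<lambda>e. the (emap \<phi> e)) (edges (Dom \<phi>))"
  proof (rule inj_onI)
    fix x y
    assume xy: "x \<in> edges (Dom \<phi>)" "y \<in> edges (Dom \<phi>)" "the (emap \<phi> x) = the (emap \<phi> y)"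
    then have "x \<in> dom (emap \<phi>)" "y \<in> dom (emap \<phi>)"
      using assms by (auto simp: graph_iso_def)
    with xy have "emap \<phi> x = emap \<phi> y"
      by auto
    with xy show "x = y"
      using assms by (auto simp: graph_iso_def dest: inj_onD)
  qed
  moreover have "(\<lambda>v. the (vmap \<phi> v)) ` verts (Dom \<phi>) \<subseteq> verts (Img \<phi>)"
  proof clarify
    fix v assume "v \<in> verts (Dom \<phi>)"
    then have "v \<in> dom (vmap \<phi>)"
      using assms by (simp add: graph_iso_def)
    then have "the (vmap \<phi> v) \<in> ran (vmap \<phi>)"
      by (auto intro: ranI)
    then show "the (vmap \<phi> v) \<in> verts (Img \<phi>)"
      using assms by (simp add: graph_iso_def)
  qed
  ultimately show ?thesis
    using assms by (simp add: graph_embedding_def graph_iso_def)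
qed

lemma isomorphic_if_embedding_onto:
  assumes wf: "wf_mgraph H" "wf_mgraph J"
    and emb: "graph_embedding f g H J"
    and onto: "f ` verts H = verts J" "g ` edges H = edges J"
  shows "isomorphic H J"
proof -
  define \<phi> where "\<phi> = \<lparr>Dom = H, Img = J,
    vmap = (\<lambda>v. if v \<in> verts H then Some (f v) else None),
    emap = (\<lambda>e. if e \<in> edges H then Some (g e) else None)\<rparr>"
  have "ends J (the (emap \<phi> e)) = Some (map_uprod (\<lambda>v. the (vmap \<phi> v)) d)"
    if e: "ends H e = Some d" for e d
  proof -
    \<comment> \<open>Well-formedness keeps the ends of an edge inside \<open>verts H\<close>, so
      the \<open>None\<close> branch of \<open>vmap \<phi>\<close> is never met.\<close>
    have "set_uprod d \<subseteq> verts H"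
      using wf e by (auto simp: wf_mgraph_def)
    then have "map_uprod (\<lambda>v. the (vmap \<phi> v)) d = map_uprod f d"
      by (intro uprod.map_cong) (auto simp: \<phi>_def)
    moreover have "e \<in> edges H"
      using e by (auto simp: edges_def)
    ultimately show ?thesis
      using emb e by (simp add: \<phi>_def graph_embedding_def)
  qed
  moreover have "inj_on (vmap \<phi>) (verts H)" "inj_on (emap \<phi>) (edges H)"
    using emb by (auto simp: \<phi>_def graph_embedding_def inj_on_def)
  moreover have "dom (vmap \<phi>) = verts H" "dom (emap \<phi>) = edges H"
    by (auto simp: \<phi>_def split: if_splits)
  moreover have "ran (vmap \<phi>) = verts J" "ran (emap \<phi>) = edges J"
    unfolding onto[symmetric] by (auto simp: \<phi>_def ran_def)
  ultimately have "graph_iso \<phi>"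
    using wf by (simp add: graph_iso_def) (simp add: \<phi>_def)
  then show ?thesis
    by (auto simp: isomorphic_def \<phi>_def)
qed

text \<open>An isomorphism onto a subgraph followed by the inclusion is an embedding; conversely the
  image of an embedding is a subgraph. In this form transitivity is composition of functions and
  antisymmetry a matter of counting.\<close>

lemma embeds_iff:
  "embeds H K \<longleftrightarrow> wf_mgraph H \<and> wf_mgraph K \<and> (\<exists>f g. graph_embedding f g H K)"
proof
  assume "embeds H K"
  then obtain J \<phi> where J: "subgraph J K" and \<phi>: "graph_iso \<phi>" "Dom \<phi> = H" "Img \<phi> = J"
    by (auto simp: embeds_def isomorphic_def)
  \<comment> \<open>The inclusion of \<open>J\<close> into \<open>K\<close>, to be composed with the
    isomorphism.\<close>
  have "graph_embedding id id J K"
    using J by (auto simp: subgraph_def graph_embedding_def map_le_def dom_def uprod.map_id)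
  with graph_iso_imp_embedding[OF \<phi>(1)] \<phi> J
  show "wf_mgraph H \<and> wf_mgraph K \<and> (\<exists>f g. graph_embedding f g H K)"
    by (auto simp: subgraph_def graph_iso_def intro: graph_embedding_trans)
next
  assume "wf_mgraph H \<and> wf_mgraph K \<and> (\<exists>f g. graph_embedding f g H K)"
  then obtain f g where wf: "wf_mgraph H" "wf_mgraph K" and emb: "graph_embedding f g H K"
    by blast
  \<comment> \<open>The image of \<open>H\<close> under \<open>f\<close> and \<open>g\<close>, with
    the incidence inherited from \<open>K\<close>.\<close>
  define J :: "('a, 'b) mgraph"
    where "J = \<lparr>verts = f ` verts H, ends = ends K |` (g ` edges H)\<rparr>"
  have edges_J: "edges J = g ` edges H"
    using graph_embedding_edges[OF emb] by (auto simp: J_def edges_def)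
  \<comment> \<open>An edge of \<open>J\<close> comes from an edge of \<open>H\<close>, so its ends
    are \<open>f\<close>-images of vertices of \<open>H\<close>: the image is closed under taking
    ends.\<close>
  have "set_uprod d \<subseteq> verts J" if "ends J e = Some d" for e d
  proof -
    from that have "e \<in> g ` edges H" "ends K e = Some d"
      by (auto simp: J_def restrict_map_def split: if_splits)
    then obtain e' d' where "e = g e'" "ends H e' = Some d'"
      by (auto simp: edges_def)
    with emb wf \<open>ends K e = Some d\<close> have "d = map_uprod f d'" "set_uprod d' \<subseteq> verts H"
      by (auto simp: graph_embedding_def wf_mgraph_def)
    then show ?thesis
      by (auto simp: J_def uprod.set_map)
  qed
  then have wf_J: "wf_mgraph J"
    using wf edges_J by (auto simp: wf_mgraph_def J_def)
  then have "subgraph J K"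
    using wf emb by (auto simp: subgraph_def J_def graph_embedding_def map_le_def)
  moreover have "graph_embedding f g H J"
    using emb by (auto simp: J_def graph_embedding_def edges_def restrict_map_def)
  then have "isomorphic H J"
    by (rule isomorphic_if_embedding_onto[OF wf(1) wf_J]) (simp_all add: edges_J, simp add: J_def)
  ultimately show "embeds H K"
    by (auto simp: embeds_def)
qed

lemma embeds_trans: "embeds H K \<Longrightarrow> embeds K L \<Longrightarrow> embeds H L"
  by (auto simp: embeds_iff intro: graph_embedding_trans)

lemma embeds_antisym:
  assumes "embeds H K" "embeds K H"
  shows "isomorphic H K"
proof -
  obtain f g f' g' where wf: "wf_mgraph H" "wf_mgraph K"
    and emb: "graph_embedding f g H K" "graph_embedding f' g' K H"
    using assms by (auto simp: embeds_iff)
  have fin: "finite (verts H)" "finite (verts K)" "finite (edges H)" "finite (edges K)"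
    using wf by (auto simp: wf_mgraph_def)
  have inj: "inj_on f (verts H)" "inj_on f' (verts K)" "inj_on g (edges H)" "inj_on g' (edges K)"
    and sub: "f ` verts H \<subseteq> verts K" "f' ` verts K \<subseteq> verts H"
    using emb by (auto simp: graph_embedding_def)
  \<comment> \<open>Injections both ways between finite sets force equal cardinality, so each is
    onto. The type \<open>'c\<close> is left open because this is applied to vertices and to edges;
    thus \<open>f\<close> and \<open>g\<close> themselves form the isomorphism.\<close>
  have onto: "h ` A = B" if "finite A" "finite B" "inj_on h A" "h ` A \<subseteq> B" "inj_on h' B" "h' ` B \<subseteq> A"
    for h h' and A B :: "'c set"
    using that by (metis card_bij_eq card_image card_subset_eq)
  show ?thesis
  proof (rule isomorphic_if_embedding_onto[OF wf emb(1)])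
    show "f ` verts H = verts K"
      using onto fin inj sub by blast
    show "g ` edges H = edges K"
      using onto fin inj graph_embedding_edges[OF emb(1)] graph_embedding_edges[OF emb(2)] by blast
  qed
qed

text \<open>The second clause for \<open>\<B>\<close> makes \<open>B\<close> the domain of an arrow
  in \<open>I\<close>, to which the first clause for \<open>\<C>\<close> applies.\<close>

lemma generating_graphs_embeds:
  assumes "generating_graphs I \<B>" "generating_graphs I \<C>" "B \<in> \<B>"
  obtains C where "C \<in> \<C>" "embeds B C"
  using assms unfolding generating_graphs_def embeds_def[symmetric] by metis

text \<open>If \<open>B\<close> embedded into a different member \<open>B'\<close>, then
  \<open>B'\<close> could take over every domain served by \<open>B\<close>, and \<open>B\<close>
  could be dropped. In particular, distinct members are never isomorphic.\<close>

lemma ideal_basis_antichain: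
  assumes basis: "ideal_basis I \<B>" and B: "B \<in> \<B>" "B' \<in> \<B>" "embeds B B'"
  shows "B = B'"
proof (rule ccontr)
  assume "B \<noteq> B'"
  have gen: "generating_graphs I \<B>"
    using basis by (simp add: ideal_basis_def)
  have "\<exists>C\<in>\<B> - {B}. embeds (Dom a) C" if "a \<in> I" for a
  proof -
    obtain C where "C \<in> \<B>" "embeds (Dom a) C"
      using gen \<open>a \<in> I\<close> unfolding generating_graphs_def embeds_def by blast
    then show ?thesis
      using B \<open>B \<noteq> B'\<close> embeds_trans[of "Dom a" B B'] by blast
  qed
  then have "generating_graphs I (\<B> - {B})"
    using gen by (auto simp: generating_graphs_def embeds_def)
  then show False
    using basis B by (auto simp: ideal_basis_def)
qed

theorem theorem4p13:
  fixes G :: "('v, 'e) mgraph"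
    and I :: "('v, 'e) garrow set"
    and \<B> :: "('v, 'e) mgraph set"
    and \<C> :: "('v, 'e) mgraph set"
  assumes "wf_mgraph G"
    and "semigroup_ideal (Fisg G) arrow_comp I"
    and "ideal_basis I \<B>"
    and "ideal_basis I \<C>"
  shows "\<exists>f. bij_betw f \<B> \<C> \<and> (\<forall>B\<in>\<B>. isomorphic B (f B))"
proof -
  have gen: "generating_graphs I \<B>" "generating_graphs I \<C>"
    using assms by (auto simp: ideal_basis_def)
  \<comment> \<open>Embeddings in both directions are kept instead of an isomorphism, since they
    chain by \<open>embeds_trans\<close>; finiteness enters only at the end through
    \<open>embeds_antisym\<close>.\<close>
  have "\<exists>C\<in>\<C>. embeds B C \<and> embeds C B" if B: "B \<in> \<B>" for B
  proof -
    obtain C where C: "C \<in> \<C>" "embeds B C"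
      using generating_graphs_embeds[OF gen B] .
    obtain B' where B': "B' \<in> \<B>" "embeds C B'"
      using generating_graphs_embeds[OF gen(2,1) C(1)] .
    have "B = B'"
      using ideal_basis_antichain[OF assms(3) B B'(1)] embeds_trans[OF C(2) B'(2)] by blast
    with C B' show ?thesis
      by blast
  qed
  then obtain f where f: "\<And>B. B \<in> \<B> \<Longrightarrow> f B \<in> \<C> \<and> embeds B (f B) \<and> embeds (f B) B"
    by metis
  \<comment> \<open>With a common image, \<open>B\<close> embeds into \<open>f B = f B'\<close> and
    thence into \<open>B'\<close>.\<close>
  have "inj_on f \<B>"
  proof (rule inj_onI)
    fix B B' assume "B \<in> \<B>" "B' \<in> \<B>" "f B = f B'"
    then show "B = B'"
      using f embeds_trans[of B "f B" B'] ideal_basis_antichain[OF assms(3)] by metis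
  qed
  \<comment> \<open>Going from \<open>C\<close> into some \<open>B\<close> and on to
    \<open>f B\<close> stays between members of \<open>\<C>\<close>, so the antichain property of
    the second basis gives \<open>C = f B\<close>.\<close>
  moreover have "C \<in> f ` \<B>" if C: "C \<in> \<C>" for C
  proof -
    obtain B where "B \<in> \<B>" "embeds C B"
      using generating_graphs_embeds[OF gen(2,1) C] .
    then have "C = f B"
      using f C embeds_trans[of C B "f B"] ideal_basis_antichain[OF assms(4)] by blast
    then show ?thesis
      using \<open>B \<in> \<B>\<close> by blast
  qed
  ultimately have "bij_betw f \<B> \<C>"
    using f by (auto simp: bij_betw_def)
  then show ?thesis
    using f embeds_antisym by blast
qed

end
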